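(* Let $K$ be a finite simplicial complex with a position function $v:K_0\to\mathbb{R}^d$, let $F:\mathcal{D}\to\mathcal{B}$ be a feature map with a labeled decomposition $\hat F:\hat{\mathcal{D}}_K\to\mathcal{B}^{S(K)}$, and let $g:\mathcal{B}\to\mathbb{R}$ be a linear functional. Let $h:\mathbb{R}^m\to\mathbb{R}$ be $g\circ\hat F_\gamma\circ\hat\alpha$ for some $\gamma\in S(K)$, or $g\circ\bar F_\sigma\circ\hat\alpha$ for some $\sigma\in K$, or $g\circ\tilde F_c\circ\hat\alpha$ for some $c\in\mathcal{C}$, with $\hat F,\bar F,\tilde F,\hat\alpha$ as defined in the context. Let $Y:(\Omega,\mathcal{F},P)\to\mathbb{R}^m$ be a Borel random variable (a random weight parameter) such that $E[h(Y)]$ exists. Let $w_1,w_2,\ldots\in\mathbb{R}^m$, where each $w_k$ is drawn independently from $Y$. Then, with probability $1$, $$\lim_{n\to\infty}\left(\frac1n\sum_{k=1}^nh(w_k)\right)=E[h(Y)].$$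
   Context: Chains. $K$ is a finite abstract simplicial complex: a collection of nonempty subsets of a finite set, closed under taking nonempty subsets and containing all singletons; $K_i$ is the set of simplices of cardinality $i+1$. $S(K)$ is the $\mathbb{Z}/2$-vector space with basis $K$; its elements (chains) are identified with subsets of $K$, and $\|\gamma\|_1$ is the number of simplices in $\gamma$. Persistence. For a total order $\le$ on $K$ extending inclusion $\subseteq$ (a linear extension), the boundary matrix $D$ over $\mathbb{Z}/2$ has rows and columns indexed by $K$ in the order $\le$, with $D_{\sigma\tau}=1$ iff $\sigma\subset\tau$ and $|\sigma|=|\tau|-1$. A matrix $R$ is reduced if distinct nonzero columns have different largest row indices of nonzero entries. A persistence algorithm $\mathcal{A}$ assigns to each boundary matrix $D$ a decomposition $R=DV$ with $R$ reduced and $V$ upper triangular with ones on the diagonal. A birth-death pair is a pair $(\sigma,\tau)$ such that $\sigma$ is the largest row index of a nonzero entry in column $\tau$ of $R$. Each birth-death pair has four associated chains: the birth simplex $\sigma$, the death simplex $\tau$, the representative cycle (sum of all $\rho$ with $R_{\rho\tau}\ne0$) and the bounding chain (sum of all $\rho$ with $V_{\rho\tau}\neq0$). Fix one of these four kinds of chain as the label of birth-death pairs. Diagrams. $\mathcal{D}$ is the set of persistence diagrams, i.e. finite formal sums (multisets) $\sum_i(b_i,d_i)$ with $b_i\le d_i$ real. A labeled persistence diagram is a finite formal sum $\sum_i(b_i,d_i,\ell_i)$ with $b_i\le d_i$; $\hat{\mathcal{D}}_K$ is the set of those arising from $K$, including the empty one $0$, with labels in $S(K)$. $\varphi$ is the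 map forgetting labels. Weights. A weight on $K$ is a function $w:K\to\mathbb{R}$ with $w(\sigma)\le w(\tau)$ whenever $\sigma\subseteq\tau$; $W\subseteq\mathbb{R}^K$ is the set of weights. Fix a persistence algorithm $\mathcal{A}$ and a linear extension $\trianglelefteq$ of $\subseteq$. For $w\in W$, order $K$ by: $\sigma\le_w\tau$ iff $w(\sigma)<w(\tau)$, or $w(\sigma)=w(\tau)$ and $\sigma\trianglelefteq\tau$. Then $\hat\alpha(w)=\sum(w(\sigma),w(\tau),\gamma)$, summed over birth-death pairs $(\sigma,\tau)$ obtained by applying $\mathcal{A}$ to $(K,\le_w)$, where $\gamma$ is the label of the pair. Fix $A\subseteq\mathbb{R}^m$ and $\psi:A\to W$; define $\hat\alpha:\mathbb{R}^m\to\hat{\mathcal{D}}_K$ by $\hat\alpha(a)=\hat\alpha(\psi(a))$ for $a\in A$ and $\hat\alpha(a)=0$ (empty diagram) for $a\notin A$. Feature maps. $\mathcal{B}$ is a separable real Banach space. A feature map is a function $F:\mathcal{D}\to\mathcal{B}$. A labeled decomposition of $F$ is a map $\hat F=(\hat F_\gamma)_{\gamma\in S(K)}:\hat{\mathcal{D}}_K\to\mathcal{B}^{S(K)}$ with $\sum_{\gamma\in S(K)}\hat F_\gamma(\hat a)=F(\varphi(\hat a))$ for all $\hat a\in\hat{\mathcal{D}}_K$. The simplex distribution is $\bar F:\hat{\mathcal{D}}_K\to\mathcal{B}^K$, $\bar F_\sigma(\hat a)=\sum_{\gamma\ni\sigma}\hat F_\gamma(\hat a)/\|\gamma\|_1$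 (sum over chains containing $\sigma$). For the position function $v:K_0\to\mathbb{R}^d$ ($d\ge1$), $|\sigma|$ is the convex hull of $v(\sigma)$, $d_\sigma$ is the dimension of $|\sigma|$, and $|K|=\bigcup_\sigma|\sigma|$. Given a partition of $\mathbb{R}^d$ into translates of a half-open cube $[0,s)^d$ ($s>0$), $\mathcal{C}$ is the finite set of translates that meet $|K|$. The pixel/voxel distribution is $\tilde F:\hat{\mathcal{D}}_K\to\mathcal{B}^{\mathcal{C}}$, $\tilde F_c(\hat a)=\sum_{\sigma\in K}\frac{\operatorname{vol}_{d_\sigma}(|\sigma|\cap c)}{\operatorname{vol}_{d_\sigma}(|\sigma|)}\bar F_\sigma(\hat a)$, where $\operatorname{vol}_k$ is $k$-dimensional volume ($\operatorname{vol}_0$ is counting). Standing convention: $h$ is Borel measurable. "$E[h(Y)]$ exists" means $h(Y)$ is integrable. The $w_k$ are realizations of independent copies of $Y$. *)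

theory Defs
  imports "HOL-Probability.Probability" "HOL-Library.Z2" "HOL-Library.Disjoint_Sets"
begin

section \<open>Simplicial complexes and chains\<close>

definition abstract_simplicial_complex :: "'v set \<Rightarrow> 'v set set \<Rightarrow> bool" where
  "abstract_simplicial_complex V K \<longleftrightarrow>
     finite V \<and>
     (\<forall>\<sigma>\<in>K. \<sigma> \<noteq> {} \<and> \<sigma> \<subseteq> V) \<and>
     (\<forall>\<sigma>\<in>K. \<forall>\<tau>. \<tau> \<noteq> {} \<and> \<tau> \<subseteq> \<sigma> \<longrightarrow> \<tau> \<in> K) \<and>
     (\<forall>x\<in>V. {x} \<in> K)"

text \<open>A chain over the integers mod 2 is identified with its support, a subset of \<open>K\<close>; its
  1-norm is then its cardinality.\<close>

type_synonym 'v chain = "'v set set"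

definition chains_of :: "'v set set \<Rightarrow> 'v chain set" where
  "chains_of K = Pow K"

definition linear_extension :: "'v set set \<Rightarrow> 'v set rel \<Rightarrow> bool" where
  "linear_extension K le \<longleftrightarrow>
     linear_order_on K le \<and> (\<forall>\<sigma>\<in>K. \<forall>\<tau>\<in>K. \<sigma> \<subseteq> \<tau> \<longrightarrow> (\<sigma>, \<tau>) \<in> le)"


section \<open>Persistence\<close>

text \<open>A matrix over the integers mod 2 with rows and columns indexed by \<open>'i\<close>. Only the entries with
  indices in \<open>K\<close> are ever used; the order of the rows and columns is a separate argument.\<close>

type_synonym 'i z2mat = "'i \<Rightarrow> 'i \<Rightarrow> bit"

definition boundary_matrix :: "'v set set \<Rightarrow> 'v set z2mat" where
  "boundary_matrix K \<sigma> \<tau> =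
     (if \<sigma> \<in> K \<and> \<tau> \<in> K \<and> \<sigma> \<subset> \<tau> \<and> card \<tau> = card \<sigma> + 1 then 1 else 0)"

definition is_low :: "'i set \<Rightarrow> 'i rel \<Rightarrow> 'i z2mat \<Rightarrow> 'i \<Rightarrow> 'i \<Rightarrow> bool" where
  "is_low K le R \<sigma> \<tau> \<longleftrightarrow>
     \<sigma> \<in> K \<and> R \<sigma> \<tau> \<noteq> 0 \<and> (\<forall>\<rho>\<in>K. R \<rho> \<tau> \<noteq> 0 \<longrightarrow> (\<rho>, \<sigma>) \<in> le)"

definition reduced :: "'i set \<Rightarrow> 'i rel \<Rightarrow> 'i z2mat \<Rightarrow> bool" where
  "reduced K le R \<longleftrightarrow>
     (\<forall>\<tau>\<in>K. \<forall>\<tau>'\<in>K. \<forall>\<sigma> \<sigma>'. \<tau> \<noteq> \<tau>' \<and> is_low K le R \<sigma> \<tau> \<and> is_low K le R \<sigma>' \<tau>' \<longrightarrow> \<sigma> \<noteq> \<sigma>')"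

definition unit_upper_triangular :: "'i set \<Rightarrow> 'i rel \<Rightarrow> 'i z2mat \<Rightarrow> bool" where
  "unit_upper_triangular K le V \<longleftrightarrow>
     (\<forall>\<tau>\<in>K. V \<tau> \<tau> = 1) \<and> (\<forall>\<rho>\<in>K. \<forall>\<tau>\<in>K. V \<rho> \<tau> \<noteq> 0 \<longrightarrow> (\<rho>, \<tau>) \<in> le)"

definition reduction_of :: "'i set \<Rightarrow> 'i rel \<Rightarrow> 'i z2mat \<Rightarrow> 'i z2mat \<times> 'i z2mat \<Rightarrow> bool" where
  "reduction_of K le D RV \<longleftrightarrow>
     (let (R, V) = RV in
        (\<forall>\<sigma>\<in>K. \<forall>\<tau>\<in>K. R \<sigma> \<tau> = (\<Sum>\<rho>\<in>K. D \<sigma> \<rho> * V \<rho> \<tau>)) \<and>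
        reduced K le R \<and> unit_upper_triangular K le V)"

text \<open>A boundary matrix consists of its entries together with the order of its index set, so an
  algorithm receives both. Its output is the pair \<open>(R, V)\<close>.\<close>

type_synonym 'v algorithm =
  "'v set rel \<Rightarrow> 'v set z2mat \<Rightarrow> 'v set z2mat \<times> 'v set z2mat"

definition persistence_algorithm :: "'v set set \<Rightarrow> 'v algorithm \<Rightarrow> bool" where
  "persistence_algorithm K \<A> \<longleftrightarrow>
     (\<forall>le. linear_extension K le \<longrightarrow>
        reduction_of K le (boundary_matrix K) (\<A> le (boundary_matrix K)))"

definition birth_death_pairs ::
    "'v set set \<Rightarrow> 'v set rel \<Rightarrow> 'v set z2mat \<times> 'v set z2mat \<Rightarrow> ('v set \<times> 'v set) set" where
  "birth_death_pairs K le RV = {(\<sigma>, \<tau>). \<tau> \<in> K \<and> is_low K le (fst RV) \<sigma> \<tau>}"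

datatype label_kind = Birth_Simplex | Death_Simplex | Representative_Cycle | Bounding_Chain

fun chain_label ::
    "label_kind \<Rightarrow> 'v set set \<Rightarrow> 'v set z2mat \<times> 'v set z2mat \<Rightarrow> 'v set \<times> 'v set \<Rightarrow> 'v chain" where
  "chain_label Birth_Simplex K RV (\<sigma>, \<tau>) = {\<sigma>}"
| "chain_label Death_Simplex K RV (\<sigma>, \<tau>) = {\<tau>}"
| "chain_label Representative_Cycle K RV (\<sigma>, \<tau>) = {\<rho>\<in>K. fst RV \<rho> \<tau> \<noteq> 0}"
| "chain_label Bounding_Chain K RV (\<sigma>, \<tau>) = {\<rho>\<in>K. snd RV \<rho> \<tau> \<noteq> 0}"


section \<open>Persistence diagrams\<close>

type_synonym diagram = "(real \<times> real) multiset"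
type_synonym 'v labeled_diagram = "(real \<times> real \<times> 'v chain) multiset"

definition persistence_diagrams :: "diagram set" where
  "persistence_diagrams = {M. \<forall>(b, d) \<in> set_mset M. b \<le> d}"

definition forget_labels :: "'v labeled_diagram \<Rightarrow> diagram" where
  "forget_labels M = image_mset (\<lambda>(b, d, l). (b, d)) M"

definition weights :: "'v set set \<Rightarrow> ('v set \<Rightarrow> real) set" where
  "weights K = {w \<in> K \<rightarrow>\<^sub>E UNIV. \<forall>\<sigma>\<in>K. \<forall>\<tau>\<in>K. \<sigma> \<subseteq> \<tau> \<longrightarrow> w \<sigma> \<le> w \<tau>}"

definition weight_order :: "'v set set \<Rightarrow> 'v set rel \<Rightarrow> ('v set \<Rightarrow> real) \<Rightarrow> 'v set rel" where
  "weight_order K ext w =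
     {(\<sigma>, \<tau>) \<in> K \<times> K. w \<sigma> < w \<tau> \<or> (w \<sigma> = w \<tau> \<and> (\<sigma>, \<tau>) \<in> ext)}"

definition weight_diagram ::
    "label_kind \<Rightarrow> 'v set set \<Rightarrow> 'v algorithm \<Rightarrow> 'v set rel \<Rightarrow> ('v set \<Rightarrow> real) \<Rightarrow> 'v labeled_diagram" where
  "weight_diagram kind K \<A> ext w =
     (let le = weight_order K ext w; RV = \<A> le (boundary_matrix K) in
        image_mset (\<lambda>(\<sigma>, \<tau>). (w \<sigma>, w \<tau>, chain_label kind K RV (\<sigma>, \<tau>)))
          (mset_set (birth_death_pairs K le RV)))"

text \<open>The labeled diagrams arising from \<open>K\<close>, for the fixed kind of label, algorithm and linear
  extension.\<close>

definition labeled_diagrams ::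
    "label_kind \<Rightarrow> 'v set set \<Rightarrow> 'v algorithm \<Rightarrow> 'v set rel \<Rightarrow> 'v labeled_diagram set" where
  "labeled_diagrams kind K \<A> ext = insert {#} (weight_diagram kind K \<A> ext ` weights K)"

definition parameter_diagram ::
    "label_kind \<Rightarrow> 'v set set \<Rightarrow> 'v algorithm \<Rightarrow> 'v set rel \<Rightarrow> 'p set \<Rightarrow> ('p \<Rightarrow> 'v set \<Rightarrow> real) \<Rightarrow>
     'p \<Rightarrow> 'v labeled_diagram" where
  "parameter_diagram kind K \<A> ext A \<psi> a =
     (if a \<in> A then weight_diagram kind K \<A> ext (\<psi> a) else {#})"


section \<open>Geometric realisation and volume\<close>

text \<open>The position function is given on vertices, i.e. a vertex \<open>x\<close> stands for the 0-simplex
  \<open>{x}\<close>.\<close>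

definition geo_simplex :: "('v \<Rightarrow> 'a::euclidean_space) \<Rightarrow> 'v set \<Rightarrow> 'a set" where
  "geo_simplex v \<sigma> = convex hull (v ` \<sigma>)"

definition geo_dim :: "('v \<Rightarrow> 'a::euclidean_space) \<Rightarrow> 'v set \<Rightarrow> nat" where
  "geo_dim v \<sigma> = nat (aff_dim (geo_simplex v \<sigma>))"

definition geo_complex :: "('v \<Rightarrow> 'a::euclidean_space) \<Rightarrow> 'v set set \<Rightarrow> 'a set" where
  "geo_complex v K = (\<Union>\<sigma>\<in>K. geo_simplex v \<sigma>)"

text \<open>The \<open>k\<close>-dimensional volume of a set \<open>S\<close> that lies in some \<open>k\<close>-dimensional affine subspace: the
  Lebesgue measure of \<open>S\<close> in coordinates with respect to an origin \<open>p\<close> and an orthonormal system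
  \<open>b 0, \<dots>, b (k - 1)\<close>. Two such frames for the same subspace differ by a rigid motion; if \<open>S\<close>
  lies in several such subspaces, its volume is 0 in each of them. For \<open>k = 0\<close> the product measure
  is the unit mass on the one-point space, so the volume is counting. The frame is arbitrary if
  \<open>S\<close> lies in no \<open>k\<close>-dimensional affine subspace.\<close>

definition frame_point :: "nat \<Rightarrow> 'a::real_vector \<Rightarrow> (nat \<Rightarrow> 'a) \<Rightarrow> (nat \<Rightarrow> real) \<Rightarrow> 'a" where
  "frame_point k p b x = p + (\<Sum>i<k. x i *\<^sub>R b i)"

definition frame_for :: "nat \<Rightarrow> 'a::euclidean_space set \<Rightarrow> 'a \<Rightarrow> (nat \<Rightarrow> 'a) \<Rightarrow> bool" where
  "frame_for k S p b \<longleftrightarrow>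
     (\<forall>i<k. \<forall>j<k. b i \<bullet> b j = (if i = j then 1 else 0)) \<and> S \<subseteq> range (frame_point k p b)"

definition k_volume :: "nat \<Rightarrow> 'a::euclidean_space set \<Rightarrow> real" where
  "k_volume k S =
     (let (p, b) = (SOME (p, b). frame_for k S p b) in
        measure (PiM {..<k} (\<lambda>_. lborel)) {x \<in> {..<k} \<rightarrow>\<^sub>E UNIV. frame_point k p b x \<in> S})"

text \<open>A partition into translates of a half-open cube need not be a lattice grid.\<close>

definition cube_partition :: "real \<Rightarrow> (real ^ 'd) set set \<Rightarrow> bool" where
  "cube_partition s P \<longleftrightarrow>
     partition_on UNIV P \<and>
     (\<forall>c\<in>P. \<exists>t. c = (\<lambda>x. t + x) ` {x. \<forall>i. 0 \<le> x $ i \<and> x $ i < s})"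

definition voxels :: "('v \<Rightarrow> real ^ 'd) \<Rightarrow> 'v set set \<Rightarrow> (real ^ 'd) set set \<Rightarrow> (real ^ 'd) set set" where
  "voxels v K P = {c \<in> P. c \<inter> geo_complex v K \<noteq> {}}"


section \<open>Labeled decompositions and distributions\<close>

text \<open>A feature map is a function on \<open>persistence_diagrams\<close>; it is rendered as a total function on
  multisets, whose values elsewhere are never used. Likewise, a labeled decomposition is only
  constrained on \<open>labeled_diagrams\<close>, and its component for a chain \<open>\<gamma>\<close> only for \<open>\<gamma> \<in> chains_of K\<close>.\<close>

definition labeled_decomposition ::
    "label_kind \<Rightarrow> 'v set set \<Rightarrow> 'v algorithm \<Rightarrow> 'v set rel \<Rightarrow>
     (diagram \<Rightarrow> 'b::real_normed_vector) \<Rightarrow> ('v chain \<Rightarrow> 'v labeled_diagram \<Rightarrow> 'b) \<Rightarrow> bool" where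
  "labeled_decomposition kind K \<A> ext F Fhat \<longleftrightarrow>
     (\<forall>a \<in> labeled_diagrams kind K \<A> ext. (\<Sum>\<gamma>\<in>chains_of K. Fhat \<gamma> a) = F (forget_labels a))"

definition simplex_distribution ::
    "'v set set \<Rightarrow> ('v chain \<Rightarrow> 'v labeled_diagram \<Rightarrow> 'b::real_normed_vector) \<Rightarrow>
     'v set \<Rightarrow> 'v labeled_diagram \<Rightarrow> 'b" where
  "simplex_distribution K Fhat \<sigma> a =
     (\<Sum>\<gamma> | \<gamma> \<in> chains_of K \<and> \<sigma> \<in> \<gamma>. Fhat \<gamma> a /\<^sub>R real (card \<gamma>))"

definition voxel_distribution ::
    "('v \<Rightarrow> real ^ 'd) \<Rightarrow> 'v set set \<Rightarrow> ('v chain \<Rightarrow> 'v labeled_diagram \<Rightarrow> 'b::real_normed_vector) \<Rightarrow>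
     (real ^ 'd) set \<Rightarrow> 'v labeled_diagram \<Rightarrow> 'b" where
  "voxel_distribution v K Fhat c a =
     (\<Sum>\<sigma>\<in>K. (k_volume (geo_dim v \<sigma>) (geo_simplex v \<sigma> \<inter> c) / k_volume (geo_dim v \<sigma>) (geo_simplex v \<sigma>))
               *\<^sub>R simplex_distribution K Fhat \<sigma> a)"


section \<open>Consistency of the definitions\<close>

lemma linear_extension_weight_order:
  assumes "linear_extension K ext" "w \<in> weights K"
  shows "linear_extension K (weight_order K ext w)"
proof -
  have lin: "linear_order_on K ext" and sub: "\<And>\<sigma> \<tau>. \<sigma> \<in> K \<Longrightarrow> \<tau> \<in> K \<Longrightarrow> \<sigma> \<subseteq> \<tau> \<Longrightarrow> (\<sigma>, \<tau>) \<in> ext"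
    using assms(1) by (auto simp: linear_extension_def)
  have tr: "trans ext" and an: "antisym ext" and re: "refl_on K ext" and to: "total_on K ext"
    using lin by (auto simp: order_on_defs)
  have "trans (weight_order K ext w)"
    by (rule transI) (auto simp: weight_order_def intro: transD[OF tr])
  moreover have "antisym (weight_order K ext w)"
    by (rule antisymI) (auto simp: weight_order_def dest: antisymD[OF an])
  moreover have "refl_on K (weight_order K ext w)"
    using re by (auto simp: refl_on_def weight_order_def)
  moreover have "total_on K (weight_order K ext w)"
    using to by (auto simp: total_on_def weight_order_def)
  moreover have "weight_order K ext w \<subseteq> K \<times> K"
    by (auto simp: weight_order_def)
  moreover have "(\<sigma>, \<tau>) \<in> weight_order K ext w" if "\<sigma> \<in> K" "\<tau> \<in> K" "\<sigma> \<subseteq> \<tau>" for \<sigma> \<tau>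
    using that sub assms(2) by (force simp: weights_def weight_order_def)
  ultimately show ?thesis
    by (simp add: linear_extension_def order_on_defs)
qed

lemma chain_label_in_chains_of:
  assumes "p \<in> birth_death_pairs K le RV"
  shows "chain_label kind K RV p \<in> chains_of K"
  using assms by (cases kind) (auto simp: birth_death_pairs_def is_low_def chains_of_def)

lemma finite_birth_death_pairs: "finite K \<Longrightarrow> finite (birth_death_pairs K le RV)"
  by (rule finite_subset[of _ "K \<times> K"]) (auto simp: birth_death_pairs_def is_low_def)

lemma birth_le_death:
  assumes "persistence_algorithm K \<A>" "linear_extension K ext" "w \<in> weights K"
    and "(\<sigma>, \<tau>) \<in> birth_death_pairs K (weight_order K ext w)
                  (\<A> (weight_order K ext w) (boundary_matrix K))"
  shows "w \<sigma> \<le> w \<tau>"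
proof -
  let ?le = "weight_order K ext w"
  obtain R V where RV: "\<A> ?le (boundary_matrix K) = (R, V)"
    by fastforce
  have "reduction_of K ?le (boundary_matrix K) (R, V)"
    using assms linear_extension_weight_order RV unfolding persistence_algorithm_def by metis
  then have prod: "\<forall>\<sigma>\<in>K. \<forall>\<tau>\<in>K. R \<sigma> \<tau> = (\<Sum>\<rho>\<in>K. boundary_matrix K \<sigma> \<rho> * V \<rho> \<tau>)"
    and tri: "unit_upper_triangular K ?le V"
    by (auto simp: reduction_of_def)
  have "\<sigma> \<in> K" "\<tau> \<in> K" "R \<sigma> \<tau> \<noteq> 0"
    using assms(4) by (auto simp: RV birth_death_pairs_def is_low_def)
  then have "(\<Sum>\<rho>\<in>K. boundary_matrix K \<sigma> \<rho> * V \<rho> \<tau>) \<noteq> 0"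
    using prod by metis
  then obtain \<rho> where rho: "\<rho> \<in> K" "boundary_matrix K \<sigma> \<rho> * V \<rho> \<tau> \<noteq> 0"
    by (meson sum.neutral)
  then have "boundary_matrix K \<sigma> \<rho> \<noteq> 0" "V \<rho> \<tau> \<noteq> 0"
    using mult_zero_left mult_zero_right by metis+
  then have "\<sigma> \<subseteq> \<rho>" "(\<rho>, \<tau>) \<in> ?le"
    using tri rho(1) \<open>\<tau> \<in> K\<close>
    by (auto simp: boundary_matrix_def unit_upper_triangular_def split: if_splits)
  then show ?thesis
    using assms(3) \<open>\<sigma> \<in> K\<close> rho(1) by (force simp: weights_def weight_order_def)
qed

lemma forget_labels_in_persistence_diagrams:
  assumes "persistence_algorithm K \<A>" "linear_extension K ext" "finite K"
    and "a \<in> labeled_diagrams kind K \<A> ext"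
  shows "forget_labels a \<in> persistence_diagrams"
proof (cases "a = {#}")
  case True
  then show ?thesis
    by (simp add: forget_labels_def persistence_diagrams_def)
next
  case False
  then obtain w where w: "w \<in> weights K" "a = weight_diagram kind K \<A> ext w"
    using assms(4) by (auto simp: labeled_diagrams_def)
  show ?thesis
    using birth_le_death[OF assms(1,2) w(1)]
    by (auto simp: w(2) weight_diagram_def Let_def forget_labels_def persistence_diagrams_def
        finite_birth_death_pairs[OF assms(3)])
qed

lemma frame_for_exists:
  fixes S T :: "'a::euclidean_space set"
  assumes "aff_dim T = int k" "S \<subseteq> T"
  shows "\<exists>p b. frame_for k S p b"
proof -
  have "T \<noteq> {}"
    using assms(1) by auto
  then obtain p where p: "p \<in> T" by blast
  let ?L = "span ((\<lambda>x. x - p) ` T)"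
  have dimL: "dim ?L = k"
    using aff_dim_eq_dim_subtract[of p T] p assms(1) by (simp add: hull_inc)
  obtain B where B: "B \<subseteq> ?L" "pairwise orthogonal B" "\<And>x. x \<in> B \<Longrightarrow> norm x = 1"
      "independent B" "card B = dim ?L" "span B = ?L"
    by (rule orthonormal_basis_subspace[OF subspace_span]) blast
  have fin: "finite B"
    using B(4) by (rule independent_imp_finite)
  then obtain b where b: "bij_betw b {..<k} B"
    using ex_bij_betw_nat_finite[of B] B(5) dimL by (auto simp: atLeast0LessThan)
  have "b i \<bullet> b j = (if i = j then 1 else 0)" if "i < k" "j < k" for i j
  proof (cases "i = j")
    case True
    then show ?thesis
      using B(3)[of "b i"] bij_betwE[OF b] that by (auto simp: dot_square_norm)
  next
    case False
    then have "b i \<noteq> b j"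
      using b that by (auto simp: bij_betw_def inj_on_def)
    then show ?thesis
      using False B(2) bij_betwE[OF b] that by (auto simp: pairwise_def orthogonal_def)
  qed
  moreover have "S \<subseteq> range (frame_point k p b)"
  proof
    fix x assume "x \<in> S"
    then have "x - p \<in> span B"
      using assms(2) B(6) by (auto intro: span_base)
    then obtain u where "x - p = (\<Sum>y\<in>B. u y *\<^sub>R y)"
      using span_finite[OF fin] by auto
    also have "\<dots> = (\<Sum>i<k. u (b i) *\<^sub>R b i)"
      by (rule sum.reindex_bij_betw[OF b, symmetric])
    finally have "x = frame_point k p b (\<lambda>i. u (b i))"
      by (simp add: frame_point_def algebra_simps)
    then show "x \<in> range (frame_point k p b)" by blast
  qed
  ultimately have "frame_for k S p b"
    unfolding frame_for_def by blast
  then show ?thesis by blast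
qed

lemma k_volume_0_singleton: "k_volume 0 {x :: 'a::euclidean_space} = 1"
proof -
  obtain p b where pb: "(SOME (p, b). frame_for 0 {x} p b) = (p, b)"
    by fastforce
  have "\<exists>q. case q of (p, b) \<Rightarrow> frame_for 0 {x} p b"
    using frame_for_exists[of "{x}" 0 "{x}"] by simp
  from someI_ex[OF this] have "frame_for 0 {x} p b"
    by (simp only: pb prod.case)
  then have "{y \<in> {..<0::nat} \<rightarrow>\<^sub>E UNIV. frame_point 0 p b y \<in> {x}} = {\<lambda>_. undefined}"
    by (auto simp: frame_for_def frame_point_def)
  then show ?thesis
    unfolding k_volume_def pb by (simp add: PiM_empty Let_def measure_def)
qed

end

theory Submission
  imports Defs
begin

text \<open>The theorem is the strong law of large numbers for \<open>h (w k)\<close>, proved by Etemadi's argument. Split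
  an integrable \<open>X\<close> into its positive and negative parts, so that \<open>X \<ge> 0\<close>. Replacing \<open>X i\<close> by
  \<open>T i = X i \<cdot> 1[X i \<le> i]\<close> changes almost surely only finitely many terms, because
  \<open>\<Sum>i. P (X 0 > i) \<le> E (X 0) + 1\<close>. By pairwise independence the centred sum of the first \<open>n\<close> of the
  \<open>T i\<close> has second moment at most \<open>n E (X 0\<^sup>2; X 0 \<le> n)\<close>; divided by \<open>n\<^sup>2\<close>, this is summable along
  \<open>n = \<lceil>\<alpha> ^ j\<rceil>\<close> for every \<open>\<alpha> > 1\<close>, so the averages converge almost surely along each such
  subsequence. As the partial sums of \<open>X i \<ge> 0\<close> are monotone, the averages in between differ from these
  by a factor of at most \<open>\<alpha>\<^sup>2\<close>, and \<open>\<alpha> \<rightarrow> 1\<close> finishes the proof.\<close>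

section \<open>Averages of real sequences\<close>

lemma cesaro_mean_tendsto:
  fixes x :: "nat \<Rightarrow> real"
  assumes "x \<longlonglongrightarrow> L"
  shows "(\<lambda>n. (\<Sum>k<n. x k) / real n) \<longlonglongrightarrow> L"
proof (rule LIMSEQ_I)
  fix e :: real assume "e > 0"
  then obtain N where N: "\<And>k. k \<ge> N \<Longrightarrow> \<bar>x k - L\<bar> < e / 2"
    using LIMSEQ_D[OF assms, of "e / 2"] by auto
  define C where "C = (\<Sum>k<N. \<bar>x k - L\<bar>)"
  have bound: "\<bar>\<Sum>k<n. x k - L\<bar> \<le> C + real n * (e / 2)" for n
  proof -
    have "\<bar>\<Sum>k<n. x k - L\<bar> \<le> (\<Sum>k<n. \<bar>x k - L\<bar>)"
      by (rule sum_abs)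
    \<comment> \<open>An index below \<open>N\<close> contributes its own deviation, in total at
      most \<open>C\<close>; every later one contributes at most \<open>e / 2\<close>.\<close>
    also have "\<dots> \<le> (\<Sum>k<n. (if k < N then \<bar>x k - L\<bar> else 0) + e / 2)"
      using N \<open>e > 0\<close> by (intro sum_mono) (auto simp: not_less less_imp_le)
    also have "\<dots> = (\<Sum>k<n. if k < N then \<bar>x k - L\<bar> else 0) + real n * (e / 2)"
      by (simp add: sum.distrib)
    also have "(\<Sum>k<n. if k < N then \<bar>x k - L\<bar> else 0) = (\<Sum>k\<in>{..<n} \<inter> {..<N}. \<bar>x k - L\<bar>)"
      by (subst sum.inter_restrict) auto
    also have "\<dots> \<le> C"
      unfolding C_def by (rule sum_mono2) auto
    finally show ?thesis by simp
  qed
  \<comment> \<open>The threshold gives \<open>C < real n * (e / 2)\<close>, the other half of the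
    allowed error.\<close>
  have "norm ((\<Sum>k<n. x k) / real n - L) < e" if "n > nat \<lceil>2 * C / e\<rceil>" for n
  proof -
    have n: "real n > 2 * C / e" "n > 0"
      using that by linarith+
    have "(\<Sum>k<n. x k) / real n - L = (\<Sum>k<n. x k - L) / real n"
      using n by (simp add: sum_subtractf field_simps)
    moreover have "\<bar>\<Sum>k<n. x k - L\<bar> < e * real n"
      using bound[of n] n \<open>e > 0\<close> by (simp add: field_simps)
    ultimately show ?thesis
      using n by (simp add: field_simps)
  qed
  then show "\<exists>no. \<forall>n\<ge>no. norm ((\<Sum>k<n. x k) / real n - L) < e"
    by (intro exI[of _ "Suc (nat \<lceil>2 * C / e\<rceil>)"]) auto
qed

text \<open>For each \<open>m\<close> the bounds hold only from some \<open>n\<close> on, with a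
  threshold depending on \<open>m\<close>. One good \<open>m\<close> is enough to separate
  \<open>u\<close> from a given level on either side of \<open>L\<close>, so no uniformity in
  \<open>m\<close> is required.\<close>

lemma tendsto_squeeze_family:
  fixes u lo hi :: "nat \<Rightarrow> real"
  assumes "lo \<longlonglongrightarrow> L" "hi \<longlonglongrightarrow> L"
    and "\<And>m. \<forall>\<^sub>F n in sequentially. lo m \<le> u n \<and> u n \<le> hi m"
  shows "u \<longlonglongrightarrow> L"
proof (rule order_tendstoI)
  fix a assume "a < L"
  then obtain m where "a < lo m"
    using order_tendstoD(1)[OF assms(1)] eventually_happens by fastforce
  then show "\<forall>\<^sub>F n in sequentially. a < u n"
    using assms(3)[of m] by (auto elim: eventually_mono)
next
  fix a assume "L < a"
  then obtain m where "hi m < a"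
    using order_tendstoD(2)[OF assms(2)] eventually_happens by fastforce
  then show "\<forall>\<^sub>F n in sequentially. u n < a"
    using assms(3)[of m] by (auto elim: eventually_mono)
qed

text \<open>For \<open>k j \<le> n < k (Suc j)\<close>, monotonicity puts \<open>S n\<close> between
  \<open>S (k j)\<close> and \<open>S (k (Suc j))\<close>, and passing from \<open>n\<close> to the
  denominator of either neighbour costs at most a factor \<beta>.\<close>

lemma average_bounds_from_subsequence:
  fixes S :: "nat \<Rightarrow> real" and k :: "nat \<Rightarrow> nat"
  assumes "mono S" "\<And>n. 0 \<le> S n" and \<beta>: "\<beta> > 0"
    and k_top: "filterlim k at_top sequentially"
    and k_ratio: "\<forall>\<^sub>F j in sequentially. real (k (Suc j)) \<le> \<beta> * real (k j)"
    and lim: "(\<lambda>j. S (k j) / real (k j)) \<longlonglongrightarrow> L" and "e > 0"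
  shows "\<forall>\<^sub>F n in sequentially. (L - e) / \<beta> \<le> S n / real n \<and> S n / real n \<le> \<beta> * (L + e)"
proof -
  have "\<forall>\<^sub>F j in sequentially. L - e < S (k j) / real (k j) \<and> S (k j) / real (k j) < L + e
      \<and> real (k (Suc j)) \<le> \<beta> * real (k j) \<and> 0 < k j"
    using order_tendstoD[OF lim, of "L - e"] order_tendstoD[OF lim, of "L + e"] \<open>e > 0\<close>
      k_ratio eventually_compose_filterlim[OF eventually_gt_at_top[of 0] k_top]
    by (auto intro!: eventually_conj)
  then obtain J where J: "\<And>j. j \<ge> J \<Longrightarrow> L - e < S (k j) / real (k j)"
      "\<And>j. j \<ge> J \<Longrightarrow> S (k j) / real (k j) < L + e"
      "\<And>j. j \<ge> J \<Longrightarrow> real (k (Suc j)) \<le> \<beta> * real (k j)" "\<And>j. j \<ge> J \<Longrightarrow> 0 < k j"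
    unfolding eventually_sequentially by blast
  have "(L - e) / \<beta> \<le> S n / real n \<and> S n / real n \<le> \<beta> * (L + e)" if n: "n \<ge> k J" for n
  proof -
    \<comment> \<open>\<open>k\<close> is not assumed monotone. If no such \<open>j\<close> existed,
      induction from \<open>J\<close> would keep every later \<open>k j\<close> at or below
      \<open>n\<close>, against \<open>k_top\<close>.\<close>
    have "\<exists>j\<ge>J. k j \<le> n \<and> n < k (Suc j)"
    proof (rule ccontr)
      assume *: "\<not> ?thesis"
      have "k j \<le> n" if "j \<ge> J" for j
        using that by (induction j rule: dec_induct) (use n * in \<open>auto simp: not_less\<close>)
      moreover have "\<forall>\<^sub>F j in sequentially. n < k j"
        using eventually_compose_filterlim[OF eventually_gt_at_top k_top] .
      ultimately show False
        by (metis (full_types) eventually_sequentially le_cases linorder_not_less)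
    qed
    then obtain j where j: "j \<ge> J" "k j \<le> n" "n < k (Suc j)"
      by blast
    have pos: "0 < real (k j)" "0 < real n" "0 < real (k (Suc j))"
      using J(4)[of j] j by auto
    have ratio: "real (k (Suc j)) \<le> \<beta> * real (k j)"
      using J(3) j(1) .
    have "(L - e) / \<beta> \<le> S (k j) / real (k j) / \<beta>"
      using J(1)[OF j(1)] \<beta> by (intro divide_right_mono) auto
    also have "\<dots> = S (k j) / (\<beta> * real (k j))"
      by (simp add: mult.commute)
    also have "\<dots> \<le> S n / real n"
      using assms(2) monoD[OF assms(1) j(2)] j(3) ratio pos by (intro frac_le) auto
    finally have lower: "(L - e) / \<beta> \<le> S n / real n" .
    have "S n / real n \<le> S (k (Suc j)) / (real (k (Suc j)) / \<beta>)"
    proof (rule frac_le)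
      show "S n \<le> S (k (Suc j))"
        using monoD[OF assms(1), of n "k (Suc j)"] j(3) by simp
      have "real (k (Suc j)) / \<beta> \<le> real (k j)"
        using ratio \<beta> by (simp add: field_simps)
      then show "real (k (Suc j)) / \<beta> \<le> real n"
        using j(2) by linarith
    qed (use assms(2) pos \<beta> in auto)
    also have "\<dots> = \<beta> * (S (k (Suc j)) / real (k (Suc j)))"
      by simp
    also have "\<dots> \<le> \<beta> * (L + e)"
      using J(2)[of "Suc j"] j(1) \<beta> by (intro mult_left_mono) auto
    finally show ?thesis
      using lower by simp
  qed
  then show ?thesis
    unfolding eventually_sequentially by blast
qed

section \<open>Rounded-up powers as a subsequence\<close>

definition geometric_index :: "real \<Rightarrow> nat \<Rightarrow> nat" where
  "geometric_index \<alpha> j = nat \<lceil>\<alpha> ^ j\<rceil>"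

lemma geometric_index_bounds:
  assumes "\<alpha> > 1"
  shows "\<alpha> ^ j \<le> real (geometric_index \<alpha> j)" "real (geometric_index \<alpha> j) < \<alpha> ^ j + 1"
    "real (geometric_index \<alpha> j) \<le> 2 * \<alpha> ^ j"
proof -
  have "1 \<le> \<alpha> ^ j"
    using assms by (simp add: one_le_power)
  then have "real (geometric_index \<alpha> j) = real_of_int \<lceil>\<alpha> ^ j\<rceil>"
    unfolding geometric_index_def by simp
  then show "\<alpha> ^ j \<le> real (geometric_index \<alpha> j)" "real (geometric_index \<alpha> j) < \<alpha> ^ j + 1"
    by linarith+
  then show "real (geometric_index \<alpha> j) \<le> 2 * \<alpha> ^ j"
    using \<open>1 \<le> \<alpha> ^ j\<close> by linarith
qed

lemma realpow_at_top:
  fixes \<alpha> :: real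
  assumes "\<alpha> > 1"
  shows "filterlim (\<lambda>j. \<alpha> ^ j) at_top sequentially"
  using assms by (intro filterlim_at_infinity_imp_filterlim_at_top
      filterlim_realpow_sequentially_gt1) auto

lemma geometric_index_at_top:
  assumes "\<alpha> > 1"
  shows "filterlim (geometric_index \<alpha>) at_top sequentially"
proof -
  have "filterlim (\<lambda>j. \<alpha> ^ j) at_top sequentially"
    using assms by (rule realpow_at_top)
  then have "filterlim (\<lambda>j. real (geometric_index \<alpha> j)) at_top sequentially"
    by (rule filterlim_at_top_mono) (simp add: geometric_index_bounds(1)[OF assms])
  then show ?thesis
    by (simp add: filterlim_sequentially_iff_filterlim_real)
qed

text \<open>Rounding spoils the exact ratio \<alpha> by less than 1 in the numerator; for large
  \<open>j\<close> a second factor \<alpha> absorbs this. The threshold in the proof says exactly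
  that \<open>\<alpha> ^ (j + 1) + 1 \<le> \<alpha> ^ (j + 2)\<close>.\<close>

lemma geometric_index_ratio:
  assumes "\<alpha> > 1"
  shows "\<forall>\<^sub>F j in sequentially.
           real (geometric_index \<alpha> (Suc j)) \<le> \<alpha>\<^sup>2 * real (geometric_index \<alpha> j)"
proof -
  have "filterlim (\<lambda>j. \<alpha> ^ j) at_top sequentially"
    using assms by (rule realpow_at_top)
  then have "\<forall>\<^sub>F j in sequentially. 1 / (\<alpha> * (\<alpha> - 1)) \<le> \<alpha> ^ j"
    by (simp add: filterlim_at_top)
  then show ?thesis
  proof eventually_elim
    case (elim j)
    have "real (geometric_index \<alpha> (Suc j)) \<le> \<alpha> * \<alpha> ^ j + 1"
      using geometric_index_bounds(2)[OF assms, of "Suc j"] by simp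
    also have "1 \<le> \<alpha> * (\<alpha> - 1) * \<alpha> ^ j"
      using elim assms by (simp add: field_simps)
    also have "\<alpha> * \<alpha> ^ j + \<alpha> * (\<alpha> - 1) * \<alpha> ^ j = \<alpha>\<^sup>2 * \<alpha> ^ j"
      by (simp add: power2_eq_square algebra_simps)
    also have "\<dots> \<le> \<alpha>\<^sup>2 * real (geometric_index \<alpha> j)"
      using geometric_index_bounds(1)[OF assms] by (intro mult_left_mono) auto
    finally show ?case by simp
  qed
qed

text \<open>The ratios \<open>1 + 1 / real (Suc m)\<close> tend to 1 and are only countably many, so
  that later a single null set serves all of them.\<close>

lemma average_tendsto_from_geometric_subsequences:
  fixes x :: "nat \<Rightarrow> real"
  assumes nonneg: "\<And>k. 0 \<le> x k"
    and lim: "\<And>m. (\<lambda>j. (\<Sum>k<geometric_index (1 + 1 / real (Suc m)) j. x k)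
                     / real (geometric_index (1 + 1 / real (Suc m)) j)) \<longlonglongrightarrow> L"
  shows "(\<lambda>n. (\<Sum>k<n. x k) / real n) \<longlonglongrightarrow> L"
proof -
  \<comment> \<open>\<open>e m\<close> is both the excess of the ratio over 1 and the slack around
    \<open>L\<close>, so both outer bounds tend to \<open>L\<close> as \<open>m\<close>
    grows.\<close>
  define e where "e m = 1 / real (Suc m)" for m
  have e_pos: "e m > 0" for m
    by (simp add: e_def)
  have e_lim: "e \<longlonglongrightarrow> 0"
    unfolding e_def using LIMSEQ_inverse_real_of_nat by (simp add: inverse_eq_divide)
  show ?thesis
  proof (rule tendsto_squeeze_family)
    show "(\<lambda>m. (L - e m) / (1 + e m)\<^sup>2) \<longlonglongrightarrow> L"
      by (rule tendsto_eq_intros e_lim | simp)+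
    show "(\<lambda>m. (1 + e m)\<^sup>2 * (L + e m)) \<longlonglongrightarrow> L"
      by (rule tendsto_eq_intros e_lim | simp)+
    fix m
    have gt1: "1 + e m > 1"
      using e_pos by simp
    show "\<forall>\<^sub>F n in sequentially. (L - e m) / (1 + e m)\<^sup>2 \<le> (\<Sum>k<n. x k) / real n \<and>
        (\<Sum>k<n. x k) / real n \<le> (1 + e m)\<^sup>2 * (L + e m)"
    proof (rule average_bounds_from_subsequence[where k = "geometric_index (1 + e m)"])
      show "mono (\<lambda>n. \<Sum>k<n. x k)"
        using nonneg by (intro monoI sum_mono2) auto
      show "(\<lambda>j. (\<Sum>k<geometric_index (1 + e m) j. x k) / real (geometric_index (1 + e m) j))
          \<longlonglongrightarrow> L"
        unfolding e_def by (rule lim)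
      show "(1 + e m)\<^sup>2 > 0"
        using gt1 by simp
    qed (use gt1 e_pos nonneg geometric_index_at_top geometric_index_ratio
          in \<open>auto intro: sum_nonneg\<close>)
  qed
qed

lemma sum_geometric_tail_le:
  fixes q :: real
  assumes "0 < q" "q < 1"
  shows "(\<Sum>j=m..<n. q ^ j) \<le> q ^ m / (1 - q)"
proof (cases "m \<le> n")
  case True
  then have "(1 - q) * (\<Sum>j=m..<n. q ^ j) = q ^ m - q ^ n"
  proof (induction n rule: dec_induct)
    case (step n)
    then show ?case
      by (simp add: distrib_left) (simp add: left_diff_distrib)
  qed simp
  also have "\<dots> \<le> q ^ m"
    using assms by simp
  finally show ?thesis
    using assms by (simp add: field_simps)
qed (use assms in simp)

section \<open>Truncation\<close>

definition truncate :: "real \<Rightarrow> real \<Rightarrow> real" where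
  "truncate c x = (if x \<le> c then x else 0)"

lemma truncate_measurable [measurable]: "truncate c \<in> borel_measurable borel"
  unfolding truncate_def by measurable

text \<open>The absolute value covers negative levels, where a nonnegative \<open>x\<close> is cut
  to 0.\<close>

lemma truncate_bounds:
  assumes "0 \<le> x"
  shows "0 \<le> truncate c x" "truncate c x \<le> x" "truncate c x \<le> \<bar>c\<bar>"
  using assms by (auto simp: truncate_def)

lemma truncate_mono:
  assumes "0 \<le> x" "c \<le> d"
  shows "truncate c x \<le> truncate d x"
  using assms by (auto simp: truncate_def)

text \<open>Once integrated, this pointwise bound controls second moments along the subsequence by
  the first moment. Only those \<open>j\<close> survive the truncation whose index is at least
  \<open>x\<close>; their weights are at most \<open>1 / \<alpha> ^ j\<close>, a geometric series
  comparable to its first term, which is of order \<open>1 / x\<close>.\<close>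

lemma sum_truncate_square_le:
  assumes "\<alpha> > 1" "0 \<le> x"
  shows "(\<Sum>j<n. (truncate (real (geometric_index \<alpha> j)) x)\<^sup>2 / real (geometric_index \<alpha> j))
           \<le> 2 / (1 - 1 / \<alpha>) * x"
proof -
  define q where "q = 1 / \<alpha>"
  have q: "0 < q" "q < 1"
    using assms by (auto simp: q_def)
  \<comment> \<open>Rounding at most doubles a power, so every surviving index lies in
    \<open>J\<close>; \<open>J\<close> may contain others as well.\<close>
  define J where "J = {j. j < n \<and> x \<le> 2 * \<alpha> ^ j}"
  have "finite J"
    by (simp add: J_def)
  have "(\<Sum>j<n. (truncate (real (geometric_index \<alpha> j)) x)\<^sup>2 / real (geometric_index \<alpha> j))
      \<le> (\<Sum>j<n. if x \<le> 2 * \<alpha> ^ j then x\<^sup>2 * q ^ j else 0)"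
  proof (rule sum_mono)
    fix j
    have pow: "0 < \<alpha> ^ j"
      using assms by simp
    have "x\<^sup>2 / real (geometric_index \<alpha> j) \<le> x\<^sup>2 / \<alpha> ^ j"
      using pow geometric_index_bounds(1)[OF assms(1), of j] by (intro divide_left_mono) auto
    then show "(truncate (real (geometric_index \<alpha> j)) x)\<^sup>2 / real (geometric_index \<alpha> j)
        \<le> (if x \<le> 2 * \<alpha> ^ j then x\<^sup>2 * q ^ j else 0)"
      using geometric_index_bounds(3)[OF assms(1), of j] pow
      by (auto simp: truncate_def q_def power_one_over)
  qed
  also have "\<dots> = (\<Sum>j\<in>J. x\<^sup>2 * q ^ j)"
    unfolding J_def by (intro sum.mono_neutral_cong_right) auto
  also have "\<dots> \<le> 2 / (1 - q) * x"
  proof (cases "J = {}")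
    case True
    then show ?thesis
      using assms q by simp
  next
    case False
    define m where "m = Min J"
    have m: "m \<in> J" "\<And>j. j \<in> J \<Longrightarrow> m \<le> j"
      using False \<open>finite J\<close> by (auto simp: m_def)
    have "(\<Sum>j\<in>J. q ^ j) \<le> (\<Sum>j=m..<n. q ^ j)"
      using q m(2) by (intro sum_mono2) (auto simp: J_def)
    also have "\<dots> \<le> q ^ m / (1 - q)"
      using sum_geometric_tail_le[OF q] .
    finally have "x\<^sup>2 * (\<Sum>j\<in>J. q ^ j) \<le> x\<^sup>2 * (q ^ m / (1 - q))"
      by (rule mult_left_mono) simp
    then have "(\<Sum>j\<in>J. x\<^sup>2 * q ^ j) \<le> x\<^sup>2 * (q ^ m / (1 - q))"
      by (simp only: sum_distrib_left)
    also have "\<dots> = x * (x * q ^ m) / (1 - q)"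
      by (simp add: power2_eq_square)
    \<comment> \<open>Membership of \<open>m\<close> in \<open>J\<close> trades one factor
      \<open>x\<close> for the constant 2, making the bound linear in \<open>x\<close>.\<close>
    also have "x * q ^ m \<le> 2"
      using m(1) assms(1) by (simp add: J_def q_def power_one_over field_simps)
    then have "x * (x * q ^ m) / (1 - q) \<le> x * 2 / (1 - q)"
      using assms(2) q by (intro divide_right_mono mult_left_mono) auto
    finally show ?thesis
      by (simp add: mult.commute)
  qed
  finally show ?thesis
    by (simp add: q_def)
qed

text \<open>At most \<open>\<lceil>x\<rceil>\<close> naturals lie strictly below \<open>x\<close>.
  Applied to \<open>X 0\<close> and integrated, this bounds the sum of the tail probabilities by the
  mean plus 1.\<close>

lemma sum_less_indicator_le:
  fixes x :: real
  assumes "0 \<le> x"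
  shows "(\<Sum>k<n. if real k < x then 1 else 0 :: real) \<le> x + 1"
proof -
  have "(\<Sum>k<n. if real k < x then 1 else 0 :: real) = real (card {k \<in> {..<n}. real k < x})"
    by (simp add: sum.If_cases Int_def)
  also have "card {k \<in> {..<n}. real k < x} \<le> card {..<nat \<lceil>x\<rceil>}"
    by (intro card_mono) (auto, linarith)
  also have "real (card {..<nat \<lceil>x\<rceil>}) \<le> x + 1"
    using assms by simp
  finally show ?thesis by simp
qed

section \<open>The strong law of large numbers\<close>

text \<open>Exchanging sum and integral shows that the series of the \<open>f j\<close> has finite
  integral, so it converges almost everywhere and its terms tend to 0. Applied to indicators this is
  Borel-Cantelli; applied to squared averages it takes the place of Chebyshev's inequality.\<close>

lemma AE_tendsto_zero_if_sum_integrals_bounded: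
  fixes f :: "nat \<Rightarrow> 'a \<Rightarrow> real"
  assumes int: "\<And>j. integrable M (f j)" and nonneg: "\<And>j x. 0 \<le> f j x"
    and bound: "\<And>n. (\<Sum>j<n. integral\<^sup>L M (f j)) \<le> C"
  shows "AE x in M. (\<lambda>j. f j x) \<longlonglongrightarrow> 0"
proof -
  have [measurable]: "\<And>j. f j \<in> borel_measurable M"
    using int by auto
  have "(\<integral>\<^sup>+x. (\<Sum>j. ennreal (f j x)) \<partial>M) = (\<Sum>j. \<integral>\<^sup>+x. ennreal (f j x) \<partial>M)"
    by (rule nn_integral_suminf) measurable
  also have "\<dots> = (\<Sum>j. ennreal (integral\<^sup>L M (f j)))"
    using int nonneg by (simp add: nn_integral_eq_integral)
  also have "\<dots> \<le> ennreal C"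
  proof (rule suminf_le_const)
    fix n
    show "(\<Sum>j<n. ennreal (integral\<^sup>L M (f j))) \<le> ennreal C"
      using bound nonneg by (simp add: sum_ennreal ennreal_leI)
  qed simp
  finally have "(\<integral>\<^sup>+x. (\<Sum>j. ennreal (f j x)) \<partial>M) \<noteq> \<infinity>"
    by (auto simp: top_unique)
  then have "AE x in M. (\<Sum>j. ennreal (f j x)) \<noteq> \<infinity>"
    by (intro nn_integral_PInf_AE) measurable
  then show ?thesis
  proof eventually_elim
    case (elim x)
    then have "summable (\<lambda>j. f j x)"
      using nonneg by (intro summable_suminf_not_top) auto
    then show ?case
      by (rule summable_LIMSEQ_zero)
  qed
qed

text \<open>After expanding the square, independence and centring remove every term with
  \<open>i \<noteq> j\<close>. Boundedness makes all the products integrable.\<close>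

lemma (in prob_space) expectation_square_sum_pairwise_indep:
  fixes Z :: "nat \<Rightarrow> 'a \<Rightarrow> real"
  assumes rv: "\<And>i. random_variable borel (Z i)"
    and bounded: "\<And>i. \<exists>B. \<forall>x. \<bar>Z i x\<bar> \<le> B"
    and centered: "\<And>i. expectation (Z i) = 0"
    and indep: "\<And>i j. i \<noteq> j \<Longrightarrow> indep_var borel (Z i) borel (Z j)"
  shows "integrable M (\<lambda>x. (\<Sum>i<n. Z i x)\<^sup>2)"
    and "expectation (\<lambda>x. (\<Sum>i<n. Z i x)\<^sup>2) = (\<Sum>i<n. expectation (\<lambda>x. (Z i x)\<^sup>2))"
proof -
  note [measurable] = rv
  have int: "integrable M (Z i)" for i
  proof -
    obtain B where "\<And>x. \<bar>Z i x\<bar> \<le> B"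
      using bounded by blast
    then show ?thesis
      by (intro integrable_const_bound[where B = B]) auto
  qed
  have int_prod: "integrable M (\<lambda>x. Z i x * Z j x)" for i j
  proof -
    obtain B C where "\<And>x. \<bar>Z i x\<bar> \<le> B" "\<And>x. \<bar>Z j x\<bar> \<le> C"
      using bounded by metis
    then have "\<bar>Z i x * Z j x\<bar> \<le> B * C" for x
      unfolding abs_mult by (intro mult_mono') auto
    then show ?thesis
      by (intro integrable_const_bound[where B = "B * C"]) auto
  qed
  have square: "(\<Sum>i<n. Z i x)\<^sup>2 = (\<Sum>i<n. \<Sum>j<n. Z i x * Z j x)" for x
    by (simp add: power2_eq_square sum_product)
  show "integrable M (\<lambda>x. (\<Sum>i<n. Z i x)\<^sup>2)"
    unfolding square by (intro Bochner_Integration.integrable_sum int_prod)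
  have "expectation (\<lambda>x. (\<Sum>i<n. Z i x)\<^sup>2) = (\<Sum>i<n. \<Sum>j<n. expectation (\<lambda>x. Z i x * Z j x))"
    unfolding square by (simp add: int_prod)
  also have "\<dots> = (\<Sum>i<n. \<Sum>j<n. if i = j then expectation (\<lambda>x. (Z i x)\<^sup>2) else 0)"
  proof (intro sum.cong refl)
    fix i j
    show "expectation (\<lambda>x. Z i x * Z j x) = (if i = j then expectation (\<lambda>x. (Z i x)\<^sup>2) else 0)"
    proof (cases "i = j")
      case False
      then show ?thesis
        using indep_var_lebesgue_integral[OF indep[OF False] int int] by (simp add: centered)
    qed (simp add: power2_eq_square)
  qed
  also have "\<dots> = (\<Sum>i<n. expectation (\<lambda>x. (Z i x)\<^sup>2))"
    by simp
  finally show "expectation (\<lambda>x. (\<Sum>i<n. Z i x)\<^sup>2) = \<dots>" .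
qed

section \<open>Etemadi's argument for nonnegative variables\<close>

lemma (in prob_space) strong_law_nonneg:
  fixes X :: "nat \<Rightarrow> 'a \<Rightarrow> real"
  assumes indep: "\<And>i j. i \<noteq> j \<Longrightarrow> indep_var borel (X i) borel (X j)"
    and rv: "\<And>i. random_variable borel (X i)"
    and copies: "\<And>i. distr M borel (X i) = distr M borel (X 0)"
    and int: "integrable M (X 0)"
    and nonneg: "\<And>i x. 0 \<le> X i x"
  shows "AE x in M. (\<lambda>n. (\<Sum>i<n. X i x) / real n) \<longlonglongrightarrow> expectation (X 0)"
proof -
  note [measurable] = rv
  \<comment> \<open>The level grows with the index, so \<open>T i\<close> differs from
    \<open>X i\<close> only where \<open>X i x > real i\<close>; \<open>T 0\<close> is identically
    0.\<close>
  define T where "T i x = truncate (real i) (X i x)" for i x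
  define Z where "Z i x = T i x - expectation (T i)" for i x
  \<comment> \<open>Equality of laws lets every moment of a truncated \<open>X i\<close> be computed
    with \<open>X 0\<close>.\<close>
  have expectation_copy: "expectation (\<lambda>x. f (X i x)) = expectation (\<lambda>x. f (X 0 x))"
    if [measurable]: "f \<in> borel_measurable borel" for f :: "real \<Rightarrow> real" and i
    using integral_distr[of "X i" M borel f] integral_distr[of "X 0" M borel f] copies[of i] by simp
  have T_rv [measurable]: "random_variable borel (T i)" for i
    unfolding T_def by measurable
  have Z_rv [measurable]: "random_variable borel (Z i)" for i
    unfolding Z_def by measurable
  have T_bounds: "0 \<le> T i x" "T i x \<le> real i" for i x
    using truncate_bounds[OF nonneg] by (auto simp: T_def) (metis abs_of_nat)
  have int_T: "integrable M (T i)" for i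
    using T_bounds by (intro integrable_const_bound[where B = "real i"]) auto
  have T_sq_bound: "\<bar>(T i x)\<^sup>2\<bar> \<le> (real i)\<^sup>2" for i x
    using T_bounds by (simp add: power_mono)
  have int_T_sq: "integrable M (\<lambda>x. (T i x)\<^sup>2)" for i
    using T_sq_bound by (intro integrable_const_bound[where B = "(real i)\<^sup>2"]) auto
  have int_trunc_sq: "integrable M (\<lambda>x. (truncate (real n) (X 0 x))\<^sup>2)" for n
  proof -
    have "\<bar>(truncate (real n) (X 0 x))\<^sup>2\<bar> \<le> (real n)\<^sup>2" for x
      using truncate_bounds[OF nonneg[of 0 x], of "real n"] by (simp add: power_mono)
    then show ?thesis
      by (intro integrable_const_bound[where B = "(real n)\<^sup>2"]) auto
  qed

  \<comment> \<open>Borel-Cantelli for the events \<open>real i < X i x\<close>, the only ones on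
    which truncation changes a term.\<close>
  have T_eventually: "AE x in M. \<forall>\<^sub>F i in sequentially. T i x = X i x"
  proof -
    let ?f = "\<lambda>i x. if real i < X i x then 1 else 0 :: real"
    have int_f: "integrable M (\<lambda>x. if real i < X j x then 1 else 0 :: real)" for i j
      by (intro integrable_const_bound[where B = 1]) auto
    have "AE x in M. (\<lambda>i. ?f i x) \<longlonglongrightarrow> 0"
    proof (rule AE_tendsto_zero_if_sum_integrals_bounded)
      fix n
      have "(\<Sum>i<n. expectation (?f i)) = (\<Sum>i<n. expectation (\<lambda>x. if real i < X 0 x then 1 else 0))"
        by (intro sum.cong refl expectation_copy) measurable
      also have "\<dots> = expectation (\<lambda>x. \<Sum>i<n. if real i < X 0 x then 1 else 0)"
        by (rule Bochner_Integration.integral_sum[symmetric]) (rule int_f)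
      also have "\<dots> \<le> expectation (\<lambda>x. X 0 x + 1)"
        using int int_f sum_less_indicator_le[OF nonneg] by (intro integral_mono) auto
      finally show "(\<Sum>i<n. expectation (?f i)) \<le> expectation (\<lambda>x. X 0 x + 1)" .
    qed (use int_f in auto)
    then show ?thesis
    proof eventually_elim
      case (elim x)
      \<comment> \<open>The values are 0 or 1, so an indicator below 1 is 0.\<close>
      then have "\<forall>\<^sub>F i in sequentially. ?f i x < 1"
        by (rule order_tendstoD) simp
      then show ?case
        by (rule eventually_mono) (auto simp: T_def truncate_def split: if_splits)
    qed
  qed

  \<comment> \<open>The truncated means may differ from \<open>expectation (X 0)\<close>, but they
    converge to it by dominated convergence; hence so do their averages.\<close>
  have "(\<lambda>i. expectation (\<lambda>x. truncate (real i) (X 0 x))) \<longlonglongrightarrow> expectation (X 0)"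
  proof (rule integral_dominated_convergence[where w = "X 0"])
    have "(\<lambda>i. truncate (real i) (X 0 x)) \<longlonglongrightarrow> X 0 x" for x
    proof (rule tendsto_eventually)
      show "\<forall>\<^sub>F i in sequentially. truncate (real i) (X 0 x) = X 0 x"
        using eventually_ge_at_top[of "nat \<lceil>X 0 x\<rceil>"]
        by eventually_elim (simp add: truncate_def nat_le_iff ceiling_le_iff)
    qed
    then show "AE x in M. (\<lambda>i. truncate (real i) (X 0 x)) \<longlonglongrightarrow> X 0 x"
      by simp
  qed (use int truncate_bounds[OF nonneg] in auto)
  moreover have "expectation (T i) = expectation (\<lambda>x. truncate (real i) (X 0 x))" for i
    unfolding T_def by (rule expectation_copy) measurable
  ultimately have "(\<lambda>i. expectation (T i)) \<longlonglongrightarrow> expectation (X 0)"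
    by simp
  then have mean: "(\<lambda>n. (\<Sum>i<n. expectation (T i)) / real n) \<longlonglongrightarrow> expectation (X 0)"
    by (rule cesaro_mean_tendsto)

  have Z_bounded: "\<exists>B. \<forall>x. \<bar>Z i x\<bar> \<le> B" for i
  proof (intro exI allI)
    fix x
    show "\<bar>Z i x\<bar> \<le> real i + \<bar>expectation (T i)\<bar>"
      using T_bounds[of i x] by (simp add: Z_def)
  qed
  have Z_centered: "expectation (Z i) = 0" for i
    unfolding Z_def by (simp add: int_T prob_space)
  have Z_indep: "indep_var borel (Z i) borel (Z j)" if "i \<noteq> j" for i j
    using indep_var_compose[OF indep[OF that],
        of "\<lambda>y. truncate (real i) y - expectation (T i)" borel
           "\<lambda>y. truncate (real j) y - expectation (T j)" borel]
    by (simp add: Z_def[abs_def] T_def comp_def)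
  note Z_sum = expectation_square_sum_pairwise_indep[of Z, OF Z_rv Z_bounded Z_centered Z_indep]
  \<comment> \<open>A variance is at most the second moment, and raising each level from
    \<open>i\<close> to \<open>n\<close> gives all \<open>n\<close> summands one common bound in
    terms of \<open>X 0\<close>.\<close>
  have variance_bound: "expectation (\<lambda>x. (\<Sum>i<n. Z i x)\<^sup>2)
      \<le> real n * expectation (\<lambda>x. (truncate (real n) (X 0 x))\<^sup>2)" for n
  proof -
    have "expectation (\<lambda>x. (Z i x)\<^sup>2) \<le> expectation (\<lambda>x. (truncate (real n) (X 0 x))\<^sup>2)"
      if "i < n" for i
    proof -
      have "expectation (\<lambda>x. (Z i x)\<^sup>2) \<le> expectation (\<lambda>x. (T i x)\<^sup>2)"
        unfolding Z_def by (simp add: variance_eq[OF int_T int_T_sq])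
      also have "\<dots> = expectation (\<lambda>x. (truncate (real i) (X 0 x))\<^sup>2)"
        unfolding T_def by (rule expectation_copy) measurable
      also have "\<dots> \<le> expectation (\<lambda>x. (truncate (real n) (X 0 x))\<^sup>2)"
        using that nonneg
        by (intro integral_mono int_trunc_sq power_mono truncate_mono truncate_bounds) auto
      finally show ?thesis .
    qed
    then have "(\<Sum>i<n. expectation (\<lambda>x. (Z i x)\<^sup>2))
        \<le> (\<Sum>i<n. expectation (\<lambda>x. (truncate (real n) (X 0 x))\<^sup>2))"
      by (intro sum_mono) auto
    then show ?thesis
      by (simp add: Z_sum)
  qed

  have subseq: "AE x in M. (\<lambda>j. (\<Sum>i<geometric_index \<alpha> j. Z i x) / real (geometric_index \<alpha> j)) \<longlonglongrightarrow> 0"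
    if \<alpha>: "\<alpha> > 1" for \<alpha>
  proof -
    let ?k = "geometric_index \<alpha>"
    have k_pos: "0 < real (?k j)" for j
      using geometric_index_bounds(1)[OF \<alpha>, of j] zero_less_power[of \<alpha> j] \<alpha> by linarith
    have "AE x in M. (\<lambda>j. ((\<Sum>i<?k j. Z i x) / real (?k j))\<^sup>2) \<longlonglongrightarrow> 0"
    proof (rule AE_tendsto_zero_if_sum_integrals_bounded)
      show "integrable M (\<lambda>x. ((\<Sum>i<?k j. Z i x) / real (?k j))\<^sup>2)" for j
        unfolding power_divide by (intro integrable_divide Z_sum(1))
      fix n
      \<comment> \<open>One factor \<open>real (?k j)\<close> of the variance bound cancels against
        the squared denominator, leaving the weights of
        \<open>sum_truncate_square_le\<close>.\<close>
      have "(\<Sum>j<n. expectation (\<lambda>x. ((\<Sum>i<?k j. Z i x) / real (?k j))\<^sup>2))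
          \<le> (\<Sum>j<n. expectation (\<lambda>x. (truncate (real (?k j)) (X 0 x))\<^sup>2 / real (?k j)))"
      proof (rule sum_mono)
        fix j
        have "expectation (\<lambda>x. ((\<Sum>i<?k j. Z i x) / real (?k j))\<^sup>2)
            = expectation (\<lambda>x. (\<Sum>i<?k j. Z i x)\<^sup>2) / (real (?k j))\<^sup>2"
          by (simp only: power_divide integral_divide_zero)
        also have "\<dots> \<le> real (?k j) * expectation (\<lambda>x. (truncate (real (?k j)) (X 0 x))\<^sup>2) / (real (?k j))\<^sup>2"
          by (intro divide_right_mono variance_bound) simp
        also have "\<dots> = expectation (\<lambda>x. (truncate (real (?k j)) (X 0 x))\<^sup>2 / real (?k j))"
          using k_pos[of j] by (simp add: power2_eq_square)
        finally show "expectation (\<lambda>x. ((\<Sum>i<?k j. Z i x) / real (?k j))\<^sup>2) \<le> \<dots>" .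
      qed
      also have "\<dots> = expectation (\<lambda>x. \<Sum>j<n. (truncate (real (?k j)) (X 0 x))\<^sup>2 / real (?k j))"
        by (simp add: int_trunc_sq)
      also have "\<dots> \<le> expectation (\<lambda>x. 2 / (1 - 1 / \<alpha>) * X 0 x)"
      proof (rule integral_mono)
        show "integrable M (\<lambda>x. \<Sum>j<n. (truncate (real (?k j)) (X 0 x))\<^sup>2 / real (?k j))"
          by (intro Bochner_Integration.integrable_sum integrable_divide int_trunc_sq)
        show "integrable M (\<lambda>x. 2 / (1 - 1 / \<alpha>) * X 0 x)"
          by (intro integrable_mult_right int)
      qed (rule sum_truncate_square_le[OF \<alpha> nonneg])
      finally show "(\<Sum>j<n. expectation (\<lambda>x. ((\<Sum>i<?k j. Z i x) / real (?k j))\<^sup>2))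
          \<le> expectation (\<lambda>x. 2 / (1 - 1 / \<alpha>) * X 0 x)" .
    qed simp
    then show ?thesis
      by eventually_elim simp
  qed
  \<comment> \<open>Each ratio has its own null set; countability allows their union to be discarded
    at once.\<close>
  have "AE x in M. \<forall>m. (\<lambda>j. (\<Sum>i<geometric_index (1 + 1 / real (Suc m)) j. Z i x)
      / real (geometric_index (1 + 1 / real (Suc m)) j)) \<longlonglongrightarrow> 0"
    unfolding AE_all_countable by (intro allI subseq) simp
  with T_eventually show ?thesis
  proof eventually_elim
    case (elim x)
    \<comment> \<open>\<open>X i\<close> is the sum of \<open>Z i\<close>, \<open>X i - T i\<close>
      and \<open>expectation (T i)\<close>. The averages of the last two converge along all
      \<open>n\<close>, those of \<open>Z i\<close> are controlled along the subsequences.\<close>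
    have "(\<lambda>i. X i x - T i x) \<longlonglongrightarrow> 0"
      by (rule tendsto_eventually) (use elim(1) in \<open>auto elim: eventually_mono\<close>)
    then have "(\<lambda>n. (\<Sum>i<n. X i x - T i x) / real n) \<longlonglongrightarrow> 0"
      by (rule cesaro_mean_tendsto)
    then have rest: "(\<lambda>n. (\<Sum>i<n. X i x - T i x) / real n + (\<Sum>i<n. expectation (T i)) / real n)
        \<longlonglongrightarrow> expectation (X 0)"
      using tendsto_add[OF _ mean] by force
    show ?case
    proof (rule average_tendsto_from_geometric_subsequences)
      fix m
      let ?k = "geometric_index (1 + 1 / real (Suc m))"
      have "(\<lambda>j. (\<Sum>i<?k j. Z i x) / real (?k j) + ((\<Sum>i<?k j. X i x - T i x) / real (?k j)
          + (\<Sum>i<?k j. expectation (T i)) / real (?k j))) \<longlonglongrightarrow> 0 + expectation (X 0)"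
        using elim(2)
        by (intro tendsto_add filterlim_compose[OF rest geometric_index_at_top]) auto
      moreover have "(\<Sum>i<?k j. Z i x) / real (?k j) + ((\<Sum>i<?k j. X i x - T i x) / real (?k j)
          + (\<Sum>i<?k j. expectation (T i)) / real (?k j)) = (\<Sum>i<?k j. X i x) / real (?k j)" for j
      proof -
        have "(\<Sum>i<?k j. Z i x) + ((\<Sum>i<?k j. X i x - T i x) + (\<Sum>i<?k j. expectation (T i)))
            = (\<Sum>i<?k j. X i x)"
          by (simp add: Z_def sum_subtractf)
        then show ?thesis
          by (simp only: add_divide_distrib[symmetric])
      qed
      ultimately show "(\<lambda>j. (\<Sum>i<?k j. X i x) / real (?k j)) \<longlonglongrightarrow> expectation (X 0)"
        by simp
    qed (rule nonneg)
  qed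
qed

text \<open>Positive and negative parts are Borel images of \<open>X i\<close>, hence again pairwise
  independent with a common law, and integrable. The nonnegative case applies to each, and linearity
  recombines them.\<close>

theorem (in prob_space) strong_law_of_large_numbers:
  fixes X :: "nat \<Rightarrow> 'a \<Rightarrow> real"
  assumes indep: "\<And>i j. i \<noteq> j \<Longrightarrow> indep_var borel (X i) borel (X j)"
    and rv: "\<And>i. random_variable borel (X i)"
    and copies: "\<And>i. distr M borel (X i) = distr M borel (X 0)"
    and int: "integrable M (X 0)"
  shows "AE x in M. (\<lambda>n. (\<Sum>i<n. X i x) / real n) \<longlonglongrightarrow> expectation (X 0)"
proof -
  note [measurable] = rv
  have part: "AE x in M. (\<lambda>n. (\<Sum>i<n. f (X i x)) / real n) \<longlonglongrightarrow> expectation (\<lambda>x. f (X 0 x))"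
    if f [measurable]: "f \<in> borel_measurable borel" and f_nonneg: "\<And>y. 0 \<le> f y"
      and f_int: "integrable M (\<lambda>x. f (X 0 x))" for f :: "real \<Rightarrow> real"
  proof (rule strong_law_nonneg[of "\<lambda>i x. f (X i x)"])
    fix i
    have "distr M borel (\<lambda>x. f (X i x)) = distr (distr M borel (X i)) borel f" for i
      by (simp add: distr_distr comp_def)
    then show "distr M borel (\<lambda>x. f (X i x)) = distr M borel (\<lambda>x. f (X 0 x))"
      using copies[of i] by simp
    fix j :: nat assume "i \<noteq> j"
    then show "indep_var borel (\<lambda>x. f (X i x)) borel (\<lambda>x. f (X j x))"
      using indep_var_compose[OF indep f f] by (simp add: comp_def)
  qed (use f_int f_nonneg in auto)
  have pos: "integrable M (\<lambda>x. max (X 0 x) 0)" and neg: "integrable M (\<lambda>x. max (- X 0 x) 0)"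
    using int by auto
  have split: "max y 0 - max (- y) 0 = y" for y :: real
    by (simp add: max_def)
  have mean: "expectation (\<lambda>x. max (X 0 x) 0) - expectation (\<lambda>x. max (- X 0 x) 0) = expectation (X 0)"
    using Bochner_Integration.integral_diff[OF pos neg] by (simp only: split)
  have "AE x in M. (\<lambda>n. (\<Sum>i<n. max (X i x) 0) / real n) \<longlonglongrightarrow> expectation (\<lambda>x. max (X 0 x) 0)"
    by (rule part[of "\<lambda>y. max y 0"]) (use pos in auto)
  moreover have "AE x in M. (\<lambda>n. (\<Sum>i<n. max (- X i x) 0) / real n) \<longlonglongrightarrow> expectation (\<lambda>x. max (- X 0 x) 0)"
    by (rule part[of "\<lambda>y. max (- y) 0"]) (use neg in auto)
  ultimately show ?thesis
  proof eventually_elim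
    case (elim x)
    from tendsto_diff[OF elim] show ?case
      by (simp only: mean diff_divide_distrib[symmetric] sum_subtractf[symmetric] split)
  qed
qed

section \<open>Application to the sampled weight parameters\<close>

theorem theorem6p8:
  fixes V :: "'v set" and K :: "'v set set"
    and v :: "'v \<Rightarrow> real ^ 'd"
    and kind :: label_kind and \<A> :: "'v algorithm" and ext :: "'v set rel"
    and A :: "(real ^ 'm) set" and \<psi> :: "real ^ 'm \<Rightarrow> 'v set \<Rightarrow> real"
    and F :: "diagram \<Rightarrow> 'b::banach"
    and Fhat :: "'v chain \<Rightarrow> 'v labeled_diagram \<Rightarrow> 'b"
    and g :: "'b \<Rightarrow> real"
    and s :: real and P :: "(real ^ 'd) set set"
    and h :: "real ^ 'm \<Rightarrow> real"
    and M :: "'o measure" and Y :: "'o \<Rightarrow> real ^ 'm"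
    and N :: "'q measure" and w :: "nat \<Rightarrow> 'q \<Rightarrow> real ^ 'm"
  assumes complex: "abstract_simplicial_complex V K"
    and algorithm: "persistence_algorithm K \<A>"
    and extension: "linear_extension K ext"
    and parameters: "\<psi> \<in> A \<rightarrow> weights K"
    and separable: "separable_space (euclidean :: 'b topology)"
    and decomposition: "labeled_decomposition kind K \<A> ext F Fhat"
    and functional: "linear g"
    and cubes: "0 < s" "cube_partition s P"
    and h_cases:
      "(\<exists>\<gamma>\<in>chains_of K. h = g \<circ> Fhat \<gamma> \<circ> parameter_diagram kind K \<A> ext A \<psi>) \<or>
       (\<exists>\<sigma>\<in>K. h = g \<circ> simplex_distribution K Fhat \<sigma> \<circ> parameter_diagram kind K \<A> ext A \<psi>) \<or>
       (\<exists>c\<in>voxels v K P. h = g \<circ> voxel_distribution v K Fhat c \<circ> parameter_diagram kind K \<A> ext A \<psi>)"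
    and h_borel: "h \<in> borel_measurable borel"
    and Y_space: "prob_space M"
    and Y_random: "Y \<in> borel_measurable M"
    and Y_exists: "integrable M (\<lambda>\<omega>. h (Y \<omega>))"
    and w_space: "prob_space N"
    and w_indep: "prob_space.indep_vars N (\<lambda>_. borel) w {1..}"
    and w_copies: "\<And>k. 1 \<le> k \<Longrightarrow> distr N borel (w k) = distr M borel Y"
  shows "AE \<omega> in N. (\<lambda>n. (1 / real n) * (\<Sum>k = 1..n. h (w k \<omega>))) \<longlonglongrightarrow> (LINT \<omega>|M. h (Y \<omega>))"
proof -
  interpret N: prob_space N
    by (rule w_space)
  note [measurable] = h_borel Y_random
  have w_rv [measurable]: "w (Suc i) \<in> borel_measurable N" for i
    using w_indep by (auto simp: N.indep_vars_def)
  \<comment> \<open>The samples are numbered from 1, the strong law from 0; hence the shift by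
    \<open>Suc\<close>. Composition with the Borel function \<open>h\<close> turns independent
    copies of \<open>Y\<close> into independent copies of \<open>h (Y)\<close>.\<close>
  let ?X = "\<lambda>i \<omega>. h (w (Suc i) \<omega>)"
  have X_distr: "distr N borel (?X i) = distr M borel (\<lambda>\<omega>. h (Y \<omega>))" for i
  proof -
    have "distr N borel (?X i) = distr (distr N borel (w (Suc i))) borel h"
      by (simp add: distr_distr comp_def)
    also have "\<dots> = distr M borel (\<lambda>\<omega>. h (Y \<omega>))"
      by (simp add: w_copies distr_distr comp_def)
    finally show ?thesis .
  qed
  \<comment> \<open>\<open>Y\<close> and the samples live on different probability spaces.
    Integrability and mean are carried over through the shared law on the reals, by integrating the
    identity.\<close>
  have "integrable (distr N borel (?X 0)) (\<lambda>y. y)"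
    unfolding X_distr using Y_exists by (subst integrable_distr_eq) measurable
  then have X_int: "integrable N (?X 0)"
    by (subst (asm) integrable_distr_eq) measurable
  have "N.expectation (?X 0) = integral\<^sup>L (distr N borel (?X 0)) (\<lambda>y. y)"
    by (rule integral_distr[symmetric]) measurable
  also have "\<dots> = (LINT \<omega>|M. h (Y \<omega>))"
    unfolding X_distr by (rule integral_distr) measurable
  finally have X_mean: "N.expectation (?X 0) = (LINT \<omega>|M. h (Y \<omega>))" .
  have X_indep: "N.indep_var borel (?X i) borel (?X j)" if "i \<noteq> j" for i j
  proof -
    \<comment> \<open>Joint independence over disjoint singleton blocks gives independence of two
      samples; composing with evaluation and \<open>h\<close> returns to real variables.\<close>
    have "N.indep_var
        (PiM {Suc i} (\<lambda>_. borel)) (\<lambda>\<omega>. restrict (\<lambda>k. w k \<omega>) {Suc i})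
        (PiM {Suc j} (\<lambda>_. borel)) (\<lambda>\<omega>. restrict (\<lambda>k. w k \<omega>) {Suc j})"
      using that by (intro N.indep_var_restrict[OF w_indep]) auto
    from N.indep_var_compose[OF this, of "\<lambda>f. h (f (Suc i))" borel "\<lambda>f. h (f (Suc j))" borel]
    show ?thesis
      by (simp add: comp_def)
  qed
  have "AE \<omega> in N. (\<lambda>n. (\<Sum>i<n. ?X i \<omega>) / real n) \<longlonglongrightarrow> N.expectation (?X 0)"
    using X_distr by (intro N.strong_law_of_large_numbers X_indep X_int) auto
  moreover have "(\<Sum>k = 1..n. h (w k \<omega>)) = (\<Sum>i<n. ?X i \<omega>)" for n \<omega>
    by (simp add: sum.atLeast1_atMost_eq)
  ultimately show ?thesis
    by (simp only: X_mean) simp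
qed

end
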